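(* Let $\mathbf{F}$ be an infinite field. For every nonnegative integer $n$, the Krull dimension of the polynomial ring $\mathbf{F}[t_1,\ldots,t_n]$ is $n$.
   Context: A ring is a commutative ring with a multiplicative identity. A prime ideal of a ring $R$ is an ideal $\mathfrak{P}\neq R$ such that $ab\in\mathfrak{P}$ implies $a\in\mathfrak{P}$ or $b\in\mathfrak{P}$. A prime ideal chain of length $n$ in $R$ is a strictly increasing sequence of $n+1$ prime ideals of $R$. The Krull dimension of $R$ is the supremum of the lengths of prime ideal chains in $R$. For $n=0$ the polynomial ring is the field $\mathbf{F}$ itself. *)

theory Defs
  imports "HOL-Algebra.Ideal" "HOL-Library.Poly_Mapping" "HOL-Library.Extended_Nat"
begin

text \<open>
  A monomial is a finitely supported exponent function \<open>nat \<Rightarrow>\<^sub>0 nat\<close>, and a polynomial is a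
  finitely supported map from monomials to coefficients, multiplied by convolution.  The type
  \<open>(nat \<Rightarrow>\<^sub>0 nat) \<Rightarrow>\<^sub>0 'a\<close> has infinitely many variables; restricting the carrier to
  polynomials all of whose monomials involve only the variables with index in \<open>{1..n}\<close> yields
  the polynomial ring in \<open>n\<close> variables, also for \<open>n = 0\<close>.
\<close>

definition mpoly_ring :: "nat \<Rightarrow> ((nat \<Rightarrow>\<^sub>0 nat) \<Rightarrow>\<^sub>0 'a::comm_ring_1) ring" where
  "mpoly_ring n =
     \<lparr>carrier = {p. \<forall>m \<in> Poly_Mapping.keys p. Poly_Mapping.keys m \<subseteq> {1..n}},
      mult = (*), one = 1, zero = 0, add = (+)\<rparr>"

lemma cring_mpoly_ring: "cring (mpoly_ring n :: ((nat \<Rightarrow>\<^sub>0 nat) \<Rightarrow>\<^sub>0 'a::comm_ring_1) ring)"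
proof (rule cringI)
  let ?R = "mpoly_ring n :: ((nat \<Rightarrow>\<^sub>0 nat) \<Rightarrow>\<^sub>0 'a::comm_ring_1) ring"
  have plus: "p + q \<in> carrier ?R" if "p \<in> carrier ?R" "q \<in> carrier ?R" for p q
    using that Poly_Mapping.keys_add[of p q] by (auto simp: mpoly_ring_def)
  have times: "p * q \<in> carrier ?R" if "p \<in> carrier ?R" "q \<in> carrier ?R" for p q
  proof -
    have "Poly_Mapping.keys m \<subseteq> {1..n}" if m: "m \<in> Poly_Mapping.keys (p * q)" for m
    proof -
      obtain a b where "m = a + b" "a \<in> Poly_Mapping.keys p" "b \<in> Poly_Mapping.keys q"
        using m keys_mult[of p q] by blast
      with \<open>p \<in> carrier ?R\<close> \<open>q \<in> carrier ?R\<close> show ?thesis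
        using Poly_Mapping.keys_add[of a b] by (fastforce simp: mpoly_ring_def)
    qed
    then show ?thesis by (simp add: mpoly_ring_def)
  qed
  have uminus: "- p \<in> carrier ?R" if "p \<in> carrier ?R" for p
    using that by (simp add: mpoly_ring_def in_keys_iff)
  show "abelian_group ?R"
  proof (rule abelian_groupI)
    fix p assume "p \<in> carrier ?R"
    then show "\<exists>q\<in>carrier ?R. q \<oplus>\<^bsub>?R\<^esub> p = \<zero>\<^bsub>?R\<^esub>"
      by (intro bexI[of _ "- p"] uminus) (simp_all add: mpoly_ring_def)
  next
    show "p \<oplus>\<^bsub>?R\<^esub> q \<in> carrier ?R" if "p \<in> carrier ?R" "q \<in> carrier ?R" for p q
      using plus[OF that] by (simp add: mpoly_ring_def)
  qed (auto simp: mpoly_ring_def add.assoc intro: add.commute)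
  show "Group.comm_monoid ?R"
  proof (rule comm_monoidI)
    show "p \<otimes>\<^bsub>?R\<^esub> q \<in> carrier ?R" if "p \<in> carrier ?R" "q \<in> carrier ?R" for p q
      using times[OF that] by (simp add: mpoly_ring_def)
  qed (auto simp: mpoly_ring_def mult.assoc intro: mult.commute)
qed (simp add: mpoly_ring_def distrib_right)

lemma carrier_mpoly_ring_0: "carrier (mpoly_ring 0) = range (Poly_Mapping.single 0)"
proof -
  have "p = Poly_Mapping.single 0 (Poly_Mapping.lookup p 0)"
    if "\<forall>m \<in> Poly_Mapping.keys p. m = 0" for p :: "(nat \<Rightarrow>\<^sub>0 nat) \<Rightarrow>\<^sub>0 'a"
    using that by (intro poly_mapping_eqI) (auto simp: lookup_single when_def in_keys_iff)
  then show ?thesis by (auto simp: mpoly_ring_def split: if_splits)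
qed

definition prime_ideal_chain :: "('a, 'b) ring_scheme \<Rightarrow> nat \<Rightarrow> (nat \<Rightarrow> 'a set) \<Rightarrow> bool" where
  "prime_ideal_chain R n P \<longleftrightarrow> (\<forall>i\<le>n. primeideal (P i) R) \<and> strict_mono_on {..n} P"

text \<open>
  The supremum is taken in \<^typ>\<open>enat\<close>, so it is \<open>\<infinity>\<close> if the lengths are unbounded.  In the zero
  ring, which has no prime ideals, it is \<open>0\<close>.
\<close>

definition krull_dim :: "('a, 'b) ring_scheme \<Rightarrow> enat" where
  "krull_dim R = (SUP n \<in> {n. \<exists>P. prime_ideal_chain R n P}. enat n)"

end

theory Submission
  imports Defs
begin

text \<open>
  For the upper bound (Coquand and Lombardi), suppose \<open>P 0 \<subset> \<dots> \<subset> P (n + 1)\<close> are primes and pick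
  \<open>x i \<in> P (i + 1) - P i\<close>.  Counting monomials of bounded degree shows that the \<open>n + 1\<close>
  polynomials \<open>x i\<close> satisfy a nontrivial polynomial relation over the field.  Factor out of this
  relation the least power of \<open>x 0\<close>: as \<open>x 0 \<notin> P 0\<close>, the cofactor lies in \<open>P 0\<close>, and the terms of it
  still divisible by \<open>x 0\<close> lie in \<open>P 1\<close>, so the remaining terms, a relation between
  \<open>x 1, \<dots>, x n\<close>, lie in \<open>P 1\<close>.  Iterating leaves a nonzero constant in \<open>P (n + 1)\<close>.
  For the lower bound take the ideals generated by \<open>t\<^sub>1, \<dots>, t\<^sub>i\<close>: splitting off the terms
  that avoid \<open>t\<^sub>1, \<dots>, t\<^sub>i\<close> reduces their primality to the absence of zero divisors.
\<close>

subsection \<open>Linear dependence of bounded-degree polynomials\<close>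

text \<open>If \<open>v\<close> is injective on \<open>E\<close>, its image is too large to be
  independent; otherwise two equal members with coefficients 1 and -1 give the relation. Indexing by
  \<open>E\<close> matters because distinct exponent vectors may yield the same polynomial.\<close>

lemma (in vector_space) family_dependence:
  assumes "finite E" "finite T" "card T < card E" "v ` E \<subseteq> span T"
  obtains u where "\<exists>e\<in>E. u e \<noteq> 0" "(\<Sum>e\<in>E. u e *s v e) = 0"
proof (cases "inj_on v E")
  case True
  have "dependent (v ` E)"
  proof (rule ccontr)
    assume "independent (v ` E)"
    then have "card (v ` E) \<le> card T"
      using independent_span_bound[of T "v ` E"] assms by blast
    then show False using assms True by (simp add: card_image)
  qed
  then obtain u where u: "\<exists>w\<in>v ` E. u w \<noteq> 0" "(\<Sum>w\<in>v ` E. u w *s w) = 0"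
    using assms(1) by (auto simp: dependent_finite)
  show ?thesis
    by (rule that[of "u \<circ> v"]) (use u True in \<open>auto simp: sum.reindex\<close>)
next
  case False
  then obtain a b where ab: "a \<in> E" "b \<in> E" "a \<noteq> b" "v a = v b"
    by (auto simp: inj_on_def)
  define u :: "_ \<Rightarrow> 'a" where "u e = (if e = a then 1 else if e = b then - 1 else 0)" for e
  have "(\<Sum>e\<in>E. u e *s v e) = (\<Sum>e\<in>{a, b}. u e *s v e)"
    by (rule sum.mono_neutral_right) (use ab assms in \<open>auto simp: u_def\<close>)
  also have "\<dots> = 0" using ab by (simp add: u_def)
  finally show ?thesis
    by (rule that[of u, rotated]) (use ab in \<open>auto simp: u_def\<close>)
qed

text \<open>Scalars act through constant polynomials, so that linear relations are ring expressions
  to which ideal membership applies.\<close>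

lemma vector_space_poly_mapping:
  "vector_space (\<lambda>(c::'a::field) (p::'b::comm_monoid_add \<Rightarrow>\<^sub>0 'a). Poly_Mapping.single 0 c * p)"
  by unfold_locales
    (simp_all add: distrib_left distrib_right single_add mult_single flip: mult.assoc)

lemma poly_mapping_sum_single:
  "(p :: 'b \<Rightarrow>\<^sub>0 'a::comm_monoid_add) =
    (\<Sum>m\<in>Poly_Mapping.keys p. Poly_Mapping.single m (Poly_Mapping.lookup p m))"
  by (rule poly_mapping_eqI)
    (auto simp: lookup_sum lookup_single when_def in_keys_iff)

text \<open>Each exponent is bounded separately, not the total degree, so counting reduces to
  counting functions from \<open>{1..n}\<close> to \<open>{..d}\<close>.\<close>

definition bounded_monomials :: "nat \<Rightarrow> nat \<Rightarrow> (nat \<Rightarrow>\<^sub>0 nat) set" where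
  "bounded_monomials n d =
     {m. Poly_Mapping.keys m \<subseteq> {1..n} \<and> (\<forall>i. Poly_Mapping.lookup m i \<le> d)}"

lemma inj_on_restrict_lookup:
  "inj_on (\<lambda>m. restrict (Poly_Mapping.lookup m) I) {m. Poly_Mapping.keys m \<subseteq> I}"
proof (rule inj_onI, simp, rule poly_mapping_eqI)
  fix m m' :: "'a \<Rightarrow>\<^sub>0 'b" and i
  assume *: "Poly_Mapping.keys m \<subseteq> I" "Poly_Mapping.keys m' \<subseteq> I"
    "restrict (Poly_Mapping.lookup m) I = restrict (Poly_Mapping.lookup m') I"
  show "Poly_Mapping.lookup m i = Poly_Mapping.lookup m' i"
  proof (cases "i \<in> I")
    case True
    then show ?thesis using fun_cong[OF *(3), of i] by simp
  next
    case False
    then show ?thesis using *(1,2) by (metis in_keys_iff subsetD)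
  qed
qed

lemma finite_bounded_monomials: "finite (bounded_monomials n d)"
  and card_bounded_monomials_le: "card (bounded_monomials n d) \<le> Suc d ^ n"
proof -
  let ?f = "\<lambda>m. restrict (Poly_Mapping.lookup m) {1..n}"
  have inj: "inj_on ?f (bounded_monomials n d)"
    by (rule inj_on_subset[OF inj_on_restrict_lookup]) (auto simp: bounded_monomials_def)
  have sub: "?f ` bounded_monomials n d \<subseteq> {1..n} \<rightarrow>\<^sub>E {..d}"
    by (auto simp: bounded_monomials_def)
  have fin: "finite ({1..n} \<rightarrow>\<^sub>E {..d})" by (intro finite_PiE) auto
  show "finite (bounded_monomials n d)"
    using inj sub fin by (meson finite_imageD finite_subset)
  show "card (bounded_monomials n d) \<le> Suc d ^ n"
    using card_inj_on_le[OF inj sub fin] by (simp add: card_PiE)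
qed

lemma bounded_monomials_mono: "d \<le> d' \<Longrightarrow> bounded_monomials n d \<subseteq> bounded_monomials n d'"
  by (auto simp: bounded_monomials_def intro: order_trans)

lemma keys_mult_bounded:
  assumes "Poly_Mapping.keys p \<subseteq> bounded_monomials n a"
    and "Poly_Mapping.keys q \<subseteq> bounded_monomials n b"
  shows "Poly_Mapping.keys (p * q) \<subseteq> bounded_monomials n (a + b)"
proof
  fix m assume "m \<in> Poly_Mapping.keys (p * q)"
  then obtain r s where m: "m = r + s" "r \<in> Poly_Mapping.keys p" "s \<in> Poly_Mapping.keys q"
    using keys_mult[of p q] by blast
  then have "r \<in> bounded_monomials n a" "s \<in> bounded_monomials n b" using assms by auto
  then show "m \<in> bounded_monomials n (a + b)"
    using Poly_Mapping.keys_add[of r s]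
    by (auto simp: bounded_monomials_def m(1) lookup_add intro: add_mono)
qed

lemma keys_one_bounded:
  "Poly_Mapping.keys (1 :: (nat \<Rightarrow>\<^sub>0 nat) \<Rightarrow>\<^sub>0 'a::comm_ring_1) \<subseteq> bounded_monomials n 0"
  by (auto simp: bounded_monomials_def)

lemma keys_power_bounded:
  fixes p :: "(nat \<Rightarrow>\<^sub>0 nat) \<Rightarrow>\<^sub>0 'a::comm_ring_1"
  assumes "Poly_Mapping.keys p \<subseteq> bounded_monomials n d"
  shows "Poly_Mapping.keys (p ^ k) \<subseteq> bounded_monomials n (k * d)"
proof (induction k)
  case 0
  then show ?case using keys_one_bounded by simp
next
  case (Suc k)
  then show ?case using keys_mult_bounded[OF assms Suc] by simp
qed

lemma keys_prod_bounded:
  fixes p :: "'i \<Rightarrow> (nat \<Rightarrow>\<^sub>0 nat) \<Rightarrow>\<^sub>0 'a::comm_ring_1"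
  assumes "\<And>i. i \<in> I \<Longrightarrow> Poly_Mapping.keys (p i) \<subseteq> bounded_monomials n (d i)"
  shows "Poly_Mapping.keys (prod p I) \<subseteq> bounded_monomials n (sum d I)"
  using assms
proof (induction I rule: infinite_finite_induct)
  case (insert i I)
  then show ?case by (simp add: keys_mult_bounded del: One_nat_def)
qed (use keys_one_bounded in auto)

lemma mpoly_bounded:
  assumes "p \<in> carrier (mpoly_ring n)"
  obtains d where "Poly_Mapping.keys p \<subseteq> bounded_monomials n d"
proof
  \<comment> \<open>A crude bound: the sum of all exponents in all monomials of
    \<open>p\<close>.\<close>
  define d where "d = (\<Sum>m\<in>Poly_Mapping.keys p. \<Sum>i\<in>Poly_Mapping.keys m. Poly_Mapping.lookup m i)"
  have "Poly_Mapping.lookup m i \<le> d" if m: "m \<in> Poly_Mapping.keys p" for m i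
  proof (cases "i \<in> Poly_Mapping.keys m")
    case True
    then have "Poly_Mapping.lookup m i \<le> (\<Sum>i\<in>Poly_Mapping.keys m. Poly_Mapping.lookup m i)"
      by (intro member_le_sum) auto
    also have "\<dots> \<le> d" unfolding d_def using m by (intro member_le_sum) auto
    finally show ?thesis .
  qed (simp add: in_keys_iff)
  then show "Poly_Mapping.keys p \<subseteq> bounded_monomials n d"
    using assms by (auto simp: bounded_monomials_def mpoly_ring_def)
qed

text \<open>There are \<open>K ^ k\<close> products with exponents below \<open>K\<close>, all lying
  in a span of at most \<open>(K * D + 1) ^ n\<close> monomials. As \<open>n < k\<close>, the
  products outnumber the monomials once \<open>K\<close> is large.\<close>

lemma algebraic_dependence:
  fixes x :: "nat \<Rightarrow> (nat \<Rightarrow>\<^sub>0 nat) \<Rightarrow>\<^sub>0 'a::field"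
  assumes "\<And>i. i < k \<Longrightarrow> x i \<in> carrier (mpoly_ring n)" and "n < k"
  obtains K and u :: "(nat \<Rightarrow> nat) \<Rightarrow> 'a" where
    "\<exists>e\<in>{..<k} \<rightarrow>\<^sub>E {..<K}. u e \<noteq> 0"
    "(\<Sum>e\<in>{..<k} \<rightarrow>\<^sub>E {..<K}. Poly_Mapping.single 0 (u e) * (\<Prod>i<k. x i ^ e i)) = 0"
proof -
  interpret vector_space "\<lambda>(c::'a) (p :: (nat \<Rightarrow>\<^sub>0 nat) \<Rightarrow>\<^sub>0 'a). Poly_Mapping.single 0 c * p"
    by (rule vector_space_poly_mapping)
  have "\<exists>d. i < k \<longrightarrow> Poly_Mapping.keys (x i) \<subseteq> bounded_monomials n d" for i
    using mpoly_bounded[OF assms(1)] by blast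
  then obtain d where d: "\<And>i. i < k \<Longrightarrow> Poly_Mapping.keys (x i) \<subseteq> bounded_monomials n (d i)"
    by metis
  define D where "D = (\<Sum>i<k. d i)"
  \<comment> \<open>Exceeding \<open>Suc D ^ n\<close> makes the count below strict;
    \<open>K\<close> being positive gives \<open>K * D + 1 \<le> K * (D + 1)\<close>.\<close>
  define K where "K = Suc (Suc D ^ n)"
  let ?E = "{..<k} \<rightarrow>\<^sub>E {..<K}"
  let ?B = "bounded_monomials n (K * D)"
  let ?T = "(\<lambda>m. Poly_Mapping.single m (1::'a)) ` ?B"
  have fin: "finite ?E" by (intro finite_PiE) auto
  have span: "p \<in> span ?T" if "Poly_Mapping.keys p \<subseteq> ?B" for p
  proof -
    have "p = (\<Sum>m\<in>Poly_Mapping.keys p.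
        Poly_Mapping.single 0 (Poly_Mapping.lookup p m) * Poly_Mapping.single m 1)"
      by (subst poly_mapping_sum_single) (simp add: mult_single)
    also have "\<dots> \<in> span ?T"
      using that by (intro span_sum span_scale span_base) auto
    finally show ?thesis .
  qed
  have "card ?T \<le> card ?B" by (intro card_image_le finite_bounded_monomials)
  also have "\<dots> \<le> Suc (K * D) ^ n" by (rule card_bounded_monomials_le)
  also have "\<dots> \<le> (K * Suc D) ^ n" by (rule power_mono) (simp_all add: K_def)
  also have "\<dots> = K ^ n * Suc D ^ n" by (rule power_mult_distrib)
  also have "\<dots> < K ^ n * K" by (simp add: K_def)
  also have "\<dots> = K ^ Suc n" by simp
  also have "\<dots> \<le> K ^ k" by (rule power_increasing) (use assms(2) in \<open>auto simp: K_def\<close>)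
  also have "\<dots> = card ?E" by (simp add: card_PiE)
  finally have card: "card ?T < card ?E" .
  have "(\<Prod>i<k. x i ^ e i) \<in> span ?T" if e: "e \<in> ?E" for e
  proof (rule span)
    have "Poly_Mapping.keys (\<Prod>i<k. x i ^ e i) \<subseteq> bounded_monomials n (\<Sum>i<k. e i * d i)"
      by (intro keys_prod_bounded keys_power_bounded d) auto
    also have "\<dots> \<subseteq> ?B"
    proof (rule bounded_monomials_mono)
      have "(\<Sum>i<k. e i * d i) \<le> (\<Sum>i<k. K * d i)"
        using e by (intro sum_mono mult_right_mono) (auto simp: PiE_def Pi_def less_imp_le)
      then show "(\<Sum>i<k. e i * d i) \<le> K * D" by (simp add: D_def sum_distrib_left)
    qed
    finally show "Poly_Mapping.keys (\<Prod>i<k. x i ^ e i) \<subseteq> ?B" .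
  qed
  then have "(\<lambda>e. \<Prod>i<k. x i ^ e i) ` ?E \<subseteq> span ?T" by blast
  from family_dependence[OF fin _ card this] obtain u
    where "\<exists>e\<in>?E. u e \<noteq> 0"
      "(\<Sum>e\<in>?E. Poly_Mapping.single 0 (u e) * (\<Prod>i<k. x i ^ e i)) = 0"
    using finite_bounded_monomials by blast
  then show ?thesis by (rule that)
qed

subsection \<open>The upper bound\<close>

lemma mpoly_ring_simps [simp]:
  "mult (mpoly_ring n) = (*)" "add (mpoly_ring n) = (+)"
  "one (mpoly_ring n) = 1" "zero (mpoly_ring n) = 0"
  by (simp_all add: mpoly_ring_def)

lemma single_0_in_mpoly_ring: "Poly_Mapping.single 0 c \<in> carrier (mpoly_ring n)"
  by (auto simp: mpoly_ring_def)

lemma mult_in_mpoly_ring: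
  "p \<in> carrier (mpoly_ring n) \<Longrightarrow> q \<in> carrier (mpoly_ring n) \<Longrightarrow> p * q \<in> carrier (mpoly_ring n)"
  using cring.cring_simprules(5)[OF cring_mpoly_ring] by fastforce

lemma sum_in_mpoly_ring:
  "(\<And>i. i \<in> I \<Longrightarrow> p i \<in> carrier (mpoly_ring n)) \<Longrightarrow> sum p I \<in> carrier (mpoly_ring n)"
  using cring.cring_simprules(1,2)[OF cring_mpoly_ring]
  by (induction I rule: infinite_finite_induct) auto

lemma power_in_mpoly_ring: "p \<in> carrier (mpoly_ring n) \<Longrightarrow> p ^ k \<in> carrier (mpoly_ring n)"
  using cring.cring_simprules(6)[OF cring_mpoly_ring]
  by (induction k) (auto simp: mult_in_mpoly_ring)

lemma prod_in_mpoly_ring: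
  "(\<And>i. i \<in> I \<Longrightarrow> p i \<in> carrier (mpoly_ring n)) \<Longrightarrow> prod p I \<in> carrier (mpoly_ring n)"
  using cring.cring_simprules(6)[OF cring_mpoly_ring]
  by (induction I rule: infinite_finite_induct) (auto simp: mult_in_mpoly_ring)

section \<open>Elementary properties of a prime ideal of the polynomial ring\<close>

context
  fixes P :: "((nat \<Rightarrow>\<^sub>0 nat) \<Rightarrow>\<^sub>0 'a::field) set" and n :: nat
  assumes prime: "primeideal P (mpoly_ring n)"
begin

interpretation primeideal P "mpoly_ring n" by (rule prime)

lemma prime_zero: "0 \<in> P"
  using additive_subgroup.zero_closed[OF is_additive_subgroup] by simp

lemma prime_subset: "P \<subseteq> carrier (mpoly_ring n)"
  using a_subset .

lemma prime_add: "p \<in> P \<Longrightarrow> q \<in> P \<Longrightarrow> p + q \<in> P"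
  using additive_subgroup.a_closed[OF is_additive_subgroup] by simp

lemma prime_mult_left: "p \<in> P \<Longrightarrow> q \<in> carrier (mpoly_ring n) \<Longrightarrow> q * p \<in> P"
  using I_l_closed by simp

lemma prime_sum: "(\<And>i. i \<in> I \<Longrightarrow> p i \<in> P) \<Longrightarrow> sum p I \<in> P"
  by (induction I rule: infinite_finite_induct) (auto simp: prime_zero prime_add)

text \<open>Nonzero constants are units, and a proper ideal contains no unit.\<close>

lemma prime_single_0: "c \<noteq> 0 \<Longrightarrow> Poly_Mapping.single 0 c \<notin> P"
proof
  assume "c \<noteq> 0" "Poly_Mapping.single 0 c \<in> P"
  then have "Poly_Mapping.single 0 (inverse c) * Poly_Mapping.single 0 c \<in> P"
    by (intro prime_mult_left single_0_in_mpoly_ring)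
  then have "1 \<in> P" using \<open>c \<noteq> 0\<close> by (simp add: mult_single)
  then show False using one_imp_carrier I_notcarr by simp
qed

lemma prime_add_cancel:
  assumes "p + q \<in> P" "q \<in> P"
  shows "p \<in> P"
proof -
  have "Poly_Mapping.single 0 (- 1) * q \<in> P"
    using assms(2) by (intro prime_mult_left single_0_in_mpoly_ring)
  then have "- q \<in> P" by (simp add: single_uminus)
  then show ?thesis using prime_add[OF assms(1)] by fastforce
qed

lemma prime_power_cancel:
  assumes "x ^ k * p \<in> P" "x \<notin> P" "x \<in> carrier (mpoly_ring n)" "p \<in> carrier (mpoly_ring n)"
  shows "p \<in> P"
  using assms(1)
proof (induction k)
  case (Suc k)
  then have "x * (x ^ k * p) \<in> P" by (simp add: mult.assoc)
  then have "x ^ k * p \<in> P"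
    using I_prime[of x "x ^ k * p"] assms(2-)
    by (simp add: mult_in_mpoly_ring power_in_mpoly_ring)
  then show ?case by (rule Suc.IH)
qed simp

end

text \<open>Induction descends from \<open>j = k\<close>. The coefficients \<open>u\<close> stay
  fixed and only the support \<open>S\<close> shrinks; injectivity of the restriction says that
  different members of \<open>S\<close> stand for different monomials in the remaining variables, so
  no two terms merge and cancel.\<close>

lemma relation_not_in_prime:
  fixes P :: "nat \<Rightarrow> ((nat \<Rightarrow>\<^sub>0 nat) \<Rightarrow>\<^sub>0 'a::field) set"
  assumes prime: "\<And>i. i \<le> k \<Longrightarrow> primeideal (P i) (mpoly_ring n)"
    and mono: "\<And>i. i < k \<Longrightarrow> P i \<subseteq> P (Suc i)"
    and x: "\<And>i. i < k \<Longrightarrow> x i \<in> P (Suc i) - P i"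
    and "j \<le> k" and "finite S" "S \<noteq> {}" "\<And>e. e \<in> S \<Longrightarrow> u e \<noteq> 0"
    and "inj_on (\<lambda>e. restrict e {j..<k}) S"
  shows "(\<Sum>e\<in>S. Poly_Mapping.single 0 (u e) * (\<Prod>i\<in>{j..<k}. x i ^ e i)) \<notin> P j"
  using assms(4-)
proof (induction j arbitrary: S rule: inc_induct)
  case base
  from base(2) obtain e where "e \<in> S" by blast
  \<comment> \<open>For \<open>j = k\<close> the restriction is to the empty interval, so
    injectivity leaves a single term, a nonzero constant.\<close>
  moreover have "e' = e" if "e' \<in> S" for e'
    by (rule inj_onD[OF base(4)]) (use that \<open>e \<in> S\<close> in auto)
  ultimately have "S = {e}" by blast
  then show ?case using base prime_single_0[OF prime[of k]] by simp
next
  case (step j)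
  let ?t = "\<lambda>j e. Poly_Mapping.single 0 (u e) * (\<Prod>i\<in>{j..<k}. x i ^ e i)"
  have xc: "x i \<in> carrier (mpoly_ring n)" if "i < k" for i
    using x[OF that] prime_subset[OF prime[of "Suc i"]] that by auto
  have powtc: "x j ^ l * ?t (Suc j) e \<in> carrier (mpoly_ring n)" for l e
    by (intro mult_in_mpoly_ring single_0_in_mpoly_ring prod_in_mpoly_ring power_in_mpoly_ring xc)
      (use step.hyps in auto)
  \<comment> \<open>The largest power of \<open>x j\<close> dividing every term formally.\<close>
  define \<mu> where "\<mu> = Min ((\<lambda>e. e j) ` S)"
  have \<mu>_le: "\<mu> \<le> e j" if "e \<in> S" for e
    using that step.prems by (simp add: \<mu>_def)
  have "\<mu> \<in> (\<lambda>e. e j) ` S"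
    unfolding \<mu>_def using step.prems by (intro Min_in) auto
  then obtain e0 where e0: "e0 \<in> S" "e0 j = \<mu>" by auto
  \<comment> \<open>The terms that become free of \<open>x j\<close> after division by
    \<open>x j ^ \<mu>\<close>; \<open>e0\<close> shows that there is one.\<close>
  define S' where "S' = {e \<in> S. e j = \<mu>}"
  have Ico: "{j..<k} = insert j {Suc j..<k}" using step.hyps by auto
  show ?case
  proof
    assume *: "sum (?t j) S \<in> P j"
    have "sum (?t j) S = x j ^ \<mu> * (\<Sum>e\<in>S. x j ^ (e j - \<mu>) * ?t (Suc j) e)"
      unfolding sum_distrib_left
    proof (rule sum.cong)
      fix e assume "e \<in> S"
      then have "x j ^ e j = x j ^ \<mu> * x j ^ (e j - \<mu>)"
        using \<mu>_le by (simp flip: power_add)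
      then show "?t j e = x j ^ \<mu> * (x j ^ (e j - \<mu>) * ?t (Suc j) e)"
        by (simp add: Ico mult_ac)
    qed simp
    with * have "x j ^ \<mu> * (\<Sum>e\<in>S. x j ^ (e j - \<mu>) * ?t (Suc j) e) \<in> P j"
      by simp
    \<comment> \<open>Primality of \<open>P j\<close> and \<open>x j \<notin> P j\<close> allow the
      cancellation.\<close>
    then have "(\<Sum>e\<in>S. x j ^ (e j - \<mu>) * ?t (Suc j) e) \<in> P j"
    proof (rule prime_power_cancel[OF prime[of j], rotated])
      show "(\<Sum>e\<in>S. x j ^ (e j - \<mu>) * ?t (Suc j) e) \<in> carrier (mpoly_ring n)"
        by (intro sum_in_mpoly_ring powtc)
    qed (use x[of j] xc step.hyps in auto)
    then have "(\<Sum>e\<in>S. x j ^ (e j - \<mu>) * ?t (Suc j) e) \<in> P (Suc j)"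
      using mono[of j] step.hyps by blast
    also have "(\<Sum>e\<in>S. x j ^ (e j - \<mu>) * ?t (Suc j) e) =
        (\<Sum>e\<in>S'. x j ^ (e j - \<mu>) * ?t (Suc j) e) + (\<Sum>e\<in>S - S'. x j ^ (e j - \<mu>) * ?t (Suc j) e)"
      by (subst sum.subset_diff[of S' S]) (use step.prems in \<open>auto simp: S'_def add.commute\<close>)
    also have "(\<Sum>e\<in>S'. x j ^ (e j - \<mu>) * ?t (Suc j) e) = sum (?t (Suc j)) S'"
      by (rule sum.cong) (auto simp: S'_def)
    finally have "sum (?t (Suc j)) S' + (\<Sum>e\<in>S - S'. x j ^ (e j - \<mu>) * ?t (Suc j) e) \<in> P (Suc j)" .
    \<comment> \<open>Each of these terms keeps a factor \<open>x j\<close>, which lies in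
      \<open>P (Suc j)\<close>.\<close>
    moreover have "(\<Sum>e\<in>S - S'. x j ^ (e j - \<mu>) * ?t (Suc j) e) \<in> P (Suc j)"
    proof (rule prime_sum)
      show "primeideal (P (Suc j)) (mpoly_ring n)" using prime step.hyps by simp
    next
      fix e assume "e \<in> S - S'"
      then have "\<mu> < e j" using \<mu>_le[of e] by (auto simp: S'_def)
      then obtain l where "e j - \<mu> = Suc l" by (metis Suc_diff_Suc)
      then have "x j ^ (e j - \<mu>) * ?t (Suc j) e = (x j ^ l * ?t (Suc j) e) * x j"
        by (simp add: mult_ac)
      also have "\<dots> \<in> P (Suc j)"
        using x[of j] step.hyps by (intro prime_mult_left[OF prime] powtc) auto
      finally show "x j ^ (e j - \<mu>) * ?t (Suc j) e \<in> P (Suc j)" .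
    qed
    ultimately have "sum (?t (Suc j)) S' \<in> P (Suc j)"
      using prime_add_cancel[OF prime] step.hyps by simp
    moreover have "inj_on (\<lambda>e. restrict e {Suc j..<k}) S'"
    proof (rule inj_onI)
      fix e e' assume e: "e \<in> S'" "e' \<in> S'" "restrict e {Suc j..<k} = restrict e' {Suc j..<k}"
      \<comment> \<open>All members of \<open>S'\<close> take the value \<open>\<mu>\<close> at
        \<open>j\<close>, so dropping that coordinate loses nothing.\<close>
      have "restrict e {j..<k} i = restrict e' {j..<k} i" for i
      proof (cases "i = j")
        case True
        then show ?thesis using e(1,2) by (simp add: S'_def)
      next
        case False
        then show ?thesis using fun_cong[OF e(3), of i] by (simp add: Ico)
      qed
      then have "restrict e {j..<k} = restrict e' {j..<k}" by (rule ext)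
      then show "e = e'"
        by (rule inj_onD[OF step.prems(4)]) (use e(1,2) in \<open>simp_all add: S'_def\<close>)
    qed
    moreover have "finite S'" "S' \<noteq> {}" "\<And>e. e \<in> S' \<Longrightarrow> u e \<noteq> 0"
      using step.prems(1,3) e0 by (auto simp: S'_def)
    ultimately show False
      using step.IH by blast
  qed
qed

text \<open>If \<open>n < k\<close>, elements chosen from the successive differences satisfy a
  nontrivial relation; its value 0 lies in \<open>P 0\<close>, against
  \<open>relation_not_in_prime\<close> at \<open>j = 0\<close>.\<close>

lemma prime_ideal_chain_length_le:
  fixes P :: "nat \<Rightarrow> ((nat \<Rightarrow>\<^sub>0 nat) \<Rightarrow>\<^sub>0 'a::field) set"
  assumes "prime_ideal_chain (mpoly_ring n) k P"
  shows "k \<le> n"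
proof (rule ccontr)
  assume "\<not> k \<le> n"
  then have "n < k" by simp
  have prime: "\<And>i. i \<le> k \<Longrightarrow> primeideal (P i) (mpoly_ring n)"
    and less: "\<And>i. i < k \<Longrightarrow> P i \<subset> P (Suc i)"
    using assms by (auto simp: prime_ideal_chain_def strict_mono_on_def)
  have "\<exists>y. i < k \<longrightarrow> y \<in> P (Suc i) - P i" for i
    using less[of i] by blast
  then obtain x where x: "\<And>i. i < k \<Longrightarrow> x i \<in> P (Suc i) - P i" by metis
  have "x i \<in> carrier (mpoly_ring n)" if "i < k" for i
    using x[OF that] prime_subset[OF prime[of "Suc i"]] that by auto
  then obtain K and u :: "(nat \<Rightarrow> nat) \<Rightarrow> 'a" where
    u: "\<exists>e\<in>{..<k} \<rightarrow>\<^sub>E {..<K}. u e \<noteq> 0"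
    "(\<Sum>e\<in>{..<k} \<rightarrow>\<^sub>E {..<K}. Poly_Mapping.single 0 (u e) * (\<Prod>i<k. x i ^ e i)) = 0"
    by (rule algebraic_dependence[OF _ \<open>n < k\<close>])
  define S where "S = {e \<in> {..<k} \<rightarrow>\<^sub>E {..<K}. u e \<noteq> 0}"
  have fin: "finite ({..<k} \<rightarrow>\<^sub>E {..<K})" by (intro finite_PiE) auto
  have "(\<Sum>e\<in>S. Poly_Mapping.single 0 (u e) * (\<Prod>i\<in>{0..<k}. x i ^ e i)) = 0"
    unfolding u(2)[symmetric] atLeast0LessThan
    by (rule sum.mono_neutral_left) (use fin in \<open>auto simp: S_def\<close>)
  moreover have "(\<Sum>e\<in>S. Poly_Mapping.single 0 (u e) * (\<Prod>i\<in>{0..<k}. x i ^ e i)) \<notin> P 0"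
  proof (rule relation_not_in_prime[where P = P and x = x, OF prime _ x])
    show "P i \<subseteq> P (Suc i)" if "i < k" for i
      using less[OF that] by blast
    \<comment> \<open>Members of \<open>S\<close> are extensional on \<open>{..<k}\<close>, so at
      \<open>j = 0\<close> the restriction is the identity.\<close>
    have "restrict e {0..<k} = e" if "e \<in> S" for e
      unfolding atLeast0LessThan by (rule PiE_restrict[of _ _ "\<lambda>_. {..<K}"]) (use that in \<open>simp add: S_def\<close>)
    then show "inj_on (\<lambda>e. restrict e {0..<k}) S"
      by (intro inj_onI) metis
  qed (use u(1) fin in \<open>auto simp: S_def\<close>)
  ultimately have "0 \<notin> P 0" by simp
  then show False using prime_zero[OF prime] by blast
qed

subsection \<open>The lower bound\<close>

text \<open>The ideal generated by \<open>t\<^sub>1, \<dots>, t\<^sub>i\<close>, described through its monomials.\<close>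

definition monomial_prime :: "nat \<Rightarrow> nat \<Rightarrow> ((nat \<Rightarrow>\<^sub>0 nat) \<Rightarrow>\<^sub>0 'a::comm_ring_1) set" where
  "monomial_prime n i =
     {p \<in> carrier (mpoly_ring n). \<forall>m\<in>Poly_Mapping.keys p. Poly_Mapping.keys m \<inter> {1..i} \<noteq> {}}"

text \<open>Setting the first \<open>i\<close> variables to 0 sends a product in the ideal to 0. The
  images of the factors then multiply to 0, so one of them vanishes, and that factor lies in the
  ideal.\<close>

lemma primeideal_monomial_prime:
  "primeideal (monomial_prime n i :: ((nat \<Rightarrow>\<^sub>0 nat) \<Rightarrow>\<^sub>0 'a::field) set) (mpoly_ring n)"
proof (rule primeidealI)
  let ?R = "mpoly_ring n :: ((nat \<Rightarrow>\<^sub>0 nat) \<Rightarrow>\<^sub>0 'a) ring"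
  let ?P = "monomial_prime n i :: ((nat \<Rightarrow>\<^sub>0 nat) \<Rightarrow>\<^sub>0 'a) set"
  interpret R: cring ?R by (rule cring_mpoly_ring)
  have sub: "?P \<subseteq> carrier ?R" unfolding monomial_prime_def by blast
  have keys_P: "Poly_Mapping.keys m \<inter> {1..i} \<noteq> {}" if "p \<in> ?P" "m \<in> Poly_Mapping.keys p" for p m
    using that unfolding monomial_prime_def by blast
  have P_I: "p \<in> ?P" if "p \<in> carrier ?R"
    "\<And>m. m \<in> Poly_Mapping.keys p \<Longrightarrow> Poly_Mapping.keys m \<inter> {1..i} \<noteq> {}" for p
    unfolding monomial_prime_def by (intro CollectI conjI ballI that)
  have add: "p + q \<in> ?P" if pq: "p \<in> ?P" "q \<in> ?P" for p q
  proof (rule P_I)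
    have "p \<oplus>\<^bsub>?R\<^esub> q \<in> carrier ?R" using pq sub by (intro R.add.m_closed) blast+
    then show "p + q \<in> carrier ?R" by simp
    fix m assume "m \<in> Poly_Mapping.keys (p + q)"
    then have "m \<in> Poly_Mapping.keys p \<or> m \<in> Poly_Mapping.keys q"
      using Poly_Mapping.keys_add[of p q] by blast
    then show "Poly_Mapping.keys m \<inter> {1..i} \<noteq> {}"
      using keys_P[OF pq(1)] keys_P[OF pq(2)] by metis
  qed
  have mult: "p * q \<in> ?P" if p: "p \<in> ?P" and q: "q \<in> carrier ?R" for p q
  proof (rule P_I)
    show "p * q \<in> carrier ?R" by (rule mult_in_mpoly_ring[OF subsetD[OF sub p] q])
    fix m assume "m \<in> Poly_Mapping.keys (p * q)"
    then obtain a b where m: "m = a + b" and a: "a \<in> Poly_Mapping.keys p"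
      using keys_mult[of p q] by blast
    \<comment> \<open>Exponents are natural numbers, so adding \<open>b\<close> cancels no variable
      of \<open>a\<close>.\<close>
    have "Poly_Mapping.keys a \<subseteq> Poly_Mapping.keys m"
      by (auto simp: m in_keys_iff lookup_add)
    then show "Poly_Mapping.keys m \<inter> {1..i} \<noteq> {}"
      using keys_P[OF p a] by blast
  qed
  have uminus: "- p \<in> ?P" if "p \<in> ?P" for p
    using mult[OF that single_0_in_mpoly_ring[of "- 1"]] by (simp add: single_uminus)
  show "ideal ?P ?R"
  proof (rule idealI)
    show "subgroup ?P (add_monoid ?R)"
    proof (rule R.add.subgroupI)
      fix p assume p: "p \<in> ?P"
      then have "\<ominus>\<^bsub>?R\<^esub> p = - p"
        using uminus[OF p] sub by (intro R.minus_equality) auto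
      then show "\<ominus>\<^bsub>?R\<^esub> p \<in> ?P"
        using uminus[OF p] by simp
    next
      have "0 \<in> ?P" using R.zero_closed by (simp add: monomial_prime_def)
      then show "?P \<noteq> {}" by blast
    qed (use sub add in auto)
  qed (use mult R.ring_axioms in \<open>auto simp: mult.commute\<close>)
  have "1 \<notin> ?P" by (simp add: monomial_prime_def)
  then show "carrier ?R \<noteq> ?P" using R.one_closed by auto
  fix p q assume pq: "p \<in> carrier ?R" "q \<in> carrier ?R" "p \<otimes>\<^bsub>?R\<^esub> q \<in> ?P"
  \<comment> \<open>The substitution of 0 for the first \<open>i\<close> variables: only monomials
    avoiding them survive.\<close>
  define r where "r f = Poly_Mapping.mapp (\<lambda>m c. if Poly_Mapping.keys m \<inter> {1..i} = {} then c else 0) f"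
    for f :: "(nat \<Rightarrow>\<^sub>0 nat) \<Rightarrow>\<^sub>0 'a"
  have lookup_r: "Poly_Mapping.lookup (r f) m =
      (if Poly_Mapping.keys m \<inter> {1..i} = {} then Poly_Mapping.lookup f m else 0)" for f m
    by (auto simp: r_def lookup_mapp when_def in_keys_iff)
  have rc: "r f \<in> carrier ?R" if "f \<in> carrier ?R" for f
    using that by (auto simp: mpoly_ring_def in_keys_iff lookup_r split: if_splits)
  have diff: "f - r f \<in> ?P" if "f \<in> carrier ?R" for f
    using that by (auto simp: monomial_prime_def mpoly_ring_def in_keys_iff lookup_r lookup_minus
        split: if_splits)
  \<comment> \<open>Modulo the ideal, \<open>p\<close> and \<open>q\<close> agree with
    \<open>r p\<close> and \<open>r q\<close>, hence so do the products.\<close>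
  have "r p * r q = p * q + - ((p - r p) * q + (q - r q) * r p)"
    by (simp add: algebra_simps)
  also have "\<dots> \<in> ?P"
  proof (intro add uminus)
    show "p * q \<in> ?P" using pq by simp
  qed (intro mult diff rc pq)+
  finally have "r p * r q \<in> ?P" .
  moreover have "Poly_Mapping.keys m \<inter> {1..i} = {}" if m: "m \<in> Poly_Mapping.keys (r p * r q)" for m
  proof -
    obtain a b where "m = a + b" "a \<in> Poly_Mapping.keys (r p)" "b \<in> Poly_Mapping.keys (r q)"
      using m keys_mult[of "r p" "r q"] by blast
    then show ?thesis
      using Poly_Mapping.keys_add[of a b] by (auto simp: in_keys_iff[of _ "r _"] lookup_r split: if_splits)
  qed
  \<comment> \<open>A monomial of this product would have to both meet and avoid
    \<open>{1..i}\<close>.\<close>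
  ultimately have "Poly_Mapping.keys (r p * r q) = {}"
    using keys_P by blast
  then have "r p * r q = 0" by (simp only: keys_eq_empty)
  then have "r p = 0 \<or> r q = 0" by simp
  \<comment> \<open>If \<open>r p = 0\<close>, then \<open>p\<close> equals \<open>p - r p\<close>,
    which is in the ideal; likewise for \<open>q\<close>.\<close>
  then show "p \<in> ?P \<or> q \<in> ?P" using diff pq by fastforce
qed (rule cring_mpoly_ring)

text \<open>The chain starts at index 0 with the zero ideal, since \<open>{1..0}\<close> is empty,
  and so has \<open>n + 1\<close> members.\<close>

lemma prime_ideal_chain_monomial_prime:
  "prime_ideal_chain (mpoly_ring n) n
     (monomial_prime n :: nat \<Rightarrow> ((nat \<Rightarrow>\<^sub>0 nat) \<Rightarrow>\<^sub>0 'a::field) set)"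
  unfolding prime_ideal_chain_def
proof (intro conjI allI impI primeideal_monomial_prime)
  have "(monomial_prime n i :: ((nat \<Rightarrow>\<^sub>0 nat) \<Rightarrow>\<^sub>0 'a) set) \<subset> monomial_prime n j"
    if "i < j" "j \<le> n" for i j
  proof
    show "(monomial_prime n i :: ((nat \<Rightarrow>\<^sub>0 nat) \<Rightarrow>\<^sub>0 'a) set) \<subseteq> monomial_prime n j"
      using that by (fastforce simp: monomial_prime_def)
    \<comment> \<open>The variable of index \<open>j\<close> separates the two ideals;
      \<open>j \<le> n\<close> places it in the ring.\<close>
    have "Poly_Mapping.single (Poly_Mapping.single j 1) (1::'a) \<in> monomial_prime n j - monomial_prime n i"
      using that by (simp add: monomial_prime_def mpoly_ring_def)
    then show "(monomial_prime n i :: ((nat \<Rightarrow>\<^sub>0 nat) \<Rightarrow>\<^sub>0 'a) set) \<noteq> monomial_prime n j"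
      by blast
  qed
  then show "strict_mono_on {..n} (monomial_prime n :: nat \<Rightarrow> ((nat \<Rightarrow>\<^sub>0 nat) \<Rightarrow>\<^sub>0 'a) set)"
    by (auto simp: strict_mono_on_def)
qed

theorem theorem5:
  fixes n :: nat
  assumes "infinite (UNIV :: 'a::field set)"
  shows "krull_dim (mpoly_ring n :: ((nat \<Rightarrow>\<^sub>0 nat) \<Rightarrow>\<^sub>0 'a) ring) = enat n"
  unfolding krull_dim_def
proof (rule antisym)
  show "(SUP k \<in> {k. \<exists>P. prime_ideal_chain (mpoly_ring n :: ((nat \<Rightarrow>\<^sub>0 nat) \<Rightarrow>\<^sub>0 'a) ring) k P}. enat k)
      \<le> enat n"
    using prime_ideal_chain_length_le by (intro SUP_least) auto
  show "enat n \<le>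
      (SUP k \<in> {k. \<exists>P. prime_ideal_chain (mpoly_ring n :: ((nat \<Rightarrow>\<^sub>0 nat) \<Rightarrow>\<^sub>0 'a) ring) k P}. enat k)"
    using prime_ideal_chain_monomial_prime by (intro SUP_upper) blast
qed

end
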